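(* Let $\mathcal{G}$ be the directed graph with node set $\mathcal{N}=\{v_{0},\ldots,v_{N}\}$ and arc set $\mathcal{A}=\{(i,j):v_{i},v_{j}\in\mathcal{N},\,i\neq j\}$, where the cost of each arc $(i,j)\in\mathcal{A}$ is $d_{ij}+\gamma_{ij}$. Whenever node $v_{i}$, $i\in\{1,\ldots,N\}$, is visited by some path in $\mathcal{G}$, $E[D_{i}]$ units of the capacity resource are consumed. Let $\psi(i,C)$ be the value of the resource-constrained shortest path in $\mathcal{G}$ from node $v_{0}$ to node $v_{i}$, assuming a capacity of $C$ when starting the path at $v_{0}$. Then, for every label $\mathcal{L}$, a lower bound on the reduced cost of all ng-feasible routes that can be generated from $\mathcal{L}$ is given by $$\psi(\mathcal{L}.n,\ \mathcal{L}.rl+E[D_{\mathcal{L}.n}])+\mathcal{L}.ap+\mathcal{L}.\Gamma,$$ i.e. $\phi(\{v_0\}\oplus e\oplus\mathcal{L}.pr)\ge \psi(\mathcal{L}.n,\mathcal{L}.rl+E[D_{\mathcal{L}.n}])+\mathcal{L}.ap+\mathcal{L}.\Gamma$ for every (possibly empty) ng-feasible extension $e$ to $\mathcal{L}$.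
   Context: Setting. There are $N+1$ nodes: a depot $v_0$ and customers $v_1,\ldots,v_N$. The demand of customer $v_i$ is a random variable $D_i$ with values in the non-negative integers, probability mass function $p_{D_i}$ and finite mean $E[D_i]$; demands are independent. $d_{ij}\ge 0$ ($i,j\in\{0,\ldots,N\}$, $d_{ii}=0$) is the transportation cost from $v_i$ to $v_j$; the triangle inequality $d_{ij}\le d_{ik}+d_{kj}$ holds (symmetry is not assumed). The vehicle capacity $Q$ is a positive integer and the load factor $f$ is a positive real. For an integer $k\ge 0$ and $q\in\{0,\ldots,Q\}$, let $\Psi(k,q)=\max\{0,\lceil (k-q)/Q\rceil\}$ (number of replenishment trips needed to serve demand $k$ with remaining quantity $q$); note $Q\Psi(k,q)+q-k\in\{0,\ldots,Q\}$. Dual values. $\alpha_0=0$; $\alpha_1,\ldots,\alpha_N\in\mathbb{R}$; finitely many sets $S_k\subseteq\{v_1,\ldots,v_N\}$ with values $\beta_k\ge 0$ (dual values of partitioning constraints and rounded capacity cuts). For $i,j\in\{0,\ldots,N\}$, $\gamma_{ij}=-\alpha_j-\sum_{k}\beta_k[v_i\in S_k,\,v_j\notin S_k]$, where $[\cdot]$ is $1$ if the condition holds and $0$ otherwise. ng-sets. For each customer $v_i$ a set $\eta_i$ of customers with $v_i\in\eta_i$ is fixed. Labels. A label $\mathcal{L}$ has attributes: $n$ (index of current customer), $rl$ (remaining load), $pr$ (partial route, a finite sequence of nodes ending in $v_0$), $ap$ (a priori cost of $pr$), $\nu(q)$ for $q\in\{0,\ldots,Q\}$ (expected remaining route cost),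 $\Gamma$ (cumulative dual contribution) and $ng$ (set of customers to which a backward extension is forbidden). Write $\oplus$ for concatenation of sequences. The root label of customer $v_j$ (with $E[D_j]\le fQ$) has $n=j$, $rl=fQ-E[D_j]$, $pr=\{v_j,v_0\}$, $ap=d_{j0}$, $\nu(q)=d_{j0}$ for all $q$, $\Gamma=\gamma_{j0}$, $ng=\{v_j\}$. The (backward) extension of $\mathcal{L}$ to a single customer $v_i$ is the label $\mathcal{E}$ with $\mathcal{E}.n=i$, $\mathcal{E}.rl=\mathcal{L}.rl-E[D_i]$, $\mathcal{E}.pr=\{v_i\}\oplus\mathcal{L}.pr$, $\mathcal{E}.ap=\mathcal{L}.ap+d_{i\mathcal{L}.n}$, $\mathcal{E}.\Gamma=\mathcal{L}.\Gamma+\gamma_{i\mathcal{L}.n}$, $\mathcal{E}.ng=(\mathcal{L}.ng\cap\eta_i)\cup\{v_i\}$ and, writing $m=\mathcal{L}.n$, for $q\in\{0,\ldots,Q\}$, $$\mathcal{E}.\nu(q)=\min\Bigl\{d_{im}+\sum_{k=0}^{\infty}\bigl[(d_{m0}+d_{0m})\Psi(k,q)+\mathcal{L}.\nu(Q\Psi(k,q)+q-k)\bigr]p_{D_m}(k),\ \ d_{i0}+d_{0m}+\sum_{k=0}^{\infty}\bigl[(d_{m0}+d_{0m})\Psi(k,Q)+\mathcal{L}.\nu(Q\Psi(k,Q)+Q-k)\bigr]p_{D_m}(k)\Bigr\}.$$ This single-customer extension is ng-feasible if $\mathcal{L}.rl\ge E[D_i]$ and $v_i\notin\mathcal{L}.ng$.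 The extension of $\mathcal{L}$ to a sequence $e=\{v_{s_1},\ldots,v_{s_l}\}$ is obtained by successive single-customer extensions to $v_{s_l},v_{s_{l-1}},\ldots,v_{s_1}$ in this order, so that its partial route is $e\oplus\mathcal{L}.pr$; $e$ is an ng-feasible extension to $\mathcal{L}$ if each of these steps is ng-feasible (the empty extension always is, and leaves $\mathcal{L}$ unchanged). Labels are the root labels and everything obtained from them by ng-feasible extensions. The ng-feasible routes that can be generated from $\mathcal{L}$ are the routes $\{v_0\}\oplus e\oplus\mathcal{L}.pr$ with $e$ a (possibly empty) ng-feasible extension to $\mathcal{L}$. Reduced cost. For a label $\mathcal{L}$ with $m=\mathcal{L}.n$, the reduced cost of the route $\{v_0\}\oplus\mathcal{L}.pr$ is $$\phi(\{v_0\}\oplus\mathcal{L}.pr)=d_{0m}+\sum_{k=0}^{\infty}\bigl[(d_{m0}+d_{0m})\Psi(k,Q)+\mathcal{L}.\nu(Q\Psi(k,Q)+Q-k)\bigr]p_{D_m}(k)+\mathcal{L}.\Gamma+\gamma_{0m}.$$ Shortest paths. Paths in $\mathcal{G}$ may repeat nodes (they are walks); the value of a path is the sum of the costs of its arcs, and its capacity consumption is the sum of $E[D_i]$ over all its visits to customers $v_i$, counted with multiplicity and including the final node. $\psi(i,C)$ is the infimum (in $[-\infty,\infty]$) of the values of paths from $v_0$ to $v_i$ with capacity consumption at most $C$. *)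

theory Defs
  imports "HOL-Probability.Probability" "Graph_Theory.Weighted_Graph"
begin

text \<open>
  Node \<open>v\<^sub>i\<close> is the number \<open>i\<close>; node 0 is the depot and \<open>1, \<dots>, ncust\<close> are the customers.
  The finite family of cut sets with their dual values is indexed by \<open>k < ncuts\<close>.
\<close>

record 'w vrp =
  ncust  :: nat
  Omega  :: "'w measure"
  dem    :: "nat \<Rightarrow> 'w \<Rightarrow> nat"
  tcost  :: "nat \<Rightarrow> nat \<Rightarrow> real"
  cap    :: nat
  lfac   :: real
  alpha  :: "nat \<Rightarrow> real"
  ncuts  :: nat
  cutset :: "nat \<Rightarrow> nat set"
  beta   :: "nat \<Rightarrow> real"
  eta    :: "nat \<Rightarrow> nat set"

abbreviation customers :: "'w vrp \<Rightarrow> nat set" where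
  "customers I \<equiv> {1..ncust I}"

abbreviation nodes :: "'w vrp \<Rightarrow> nat set" where
  "nodes I \<equiv> {0..ncust I}"

locale vrpsd = prob_space "Omega I" for I :: "'w vrp" +
  assumes indep_dem: "indep_vars (\<lambda>_. count_space UNIV) (dem I) (customers I)"
    and finite_mean: "\<And>i. i \<in> customers I \<Longrightarrow> integrable (Omega I) (\<lambda>w. real (dem I i w))"
    and tcost_nonneg: "\<And>i j. i \<in> nodes I \<Longrightarrow> j \<in> nodes I \<Longrightarrow> 0 \<le> tcost I i j"
    and tcost_diag: "\<And>i. i \<in> nodes I \<Longrightarrow> tcost I i i = 0"
    and tcost_triangle: "\<And>i j k. i \<in> nodes I \<Longrightarrow> j \<in> nodes I \<Longrightarrow> k \<in> nodes I \<Longrightarrow>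
          tcost I i j \<le> tcost I i k + tcost I k j"
    and cap_pos: "0 < cap I"
    and lfac_pos: "0 < lfac I"
    and alpha_depot: "alpha I 0 = 0"
    and cutset_subset: "\<And>k. k < ncuts I \<Longrightarrow> cutset I k \<subseteq> customers I"
    and beta_nonneg: "\<And>k. k < ncuts I \<Longrightarrow> 0 \<le> beta I k"
    and eta_subset: "\<And>i. i \<in> customers I \<Longrightarrow> eta I i \<subseteq> customers I"
    and eta_self: "\<And>i. i \<in> customers I \<Longrightarrow> i \<in> eta I i"

definition dem_pmf :: "'w vrp \<Rightarrow> nat \<Rightarrow> nat \<Rightarrow> real" where
  "dem_pmf I i k = measure (Omega I) {w \<in> space (Omega I). dem I i w = k}"

definition mean_dem :: "'w vrp \<Rightarrow> nat \<Rightarrow> real" where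
  "mean_dem I i = (\<integral>w. real (dem I i w) \<partial>Omega I)"

definition Psi :: "'w vrp \<Rightarrow> nat \<Rightarrow> nat \<Rightarrow> nat" where
  "Psi I k q = nat (max 0 \<lceil>(real k - real q) / real (cap I)\<rceil>)"

definition gamma :: "'w vrp \<Rightarrow> nat \<Rightarrow> nat \<Rightarrow> real" where
  "gamma I i j =
     - alpha I j - (\<Sum>k<ncuts I. beta I k * (if i \<in> cutset I k \<and> j \<notin> cutset I k then 1 else 0))"

text \<open>
  Only the values \<open>nu q\<close> with \<open>q \<le> cap\<close> are meaningful.
\<close>

record label =
  node :: nat
  rl   :: real
  pr   :: "nat list"
  ap   :: real
  nu   :: "nat \<Rightarrow> real"
  Gam  :: real
  ng   :: "nat set"

definition root_label :: "'w vrp \<Rightarrow> nat \<Rightarrow> label" where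
  "root_label I j =
     \<lparr> node = j, rl = lfac I * real (cap I) - mean_dem I j, pr = [j, 0], ap = tcost I j 0,
       nu = (\<lambda>q. tcost I j 0), Gam = gamma I j 0, ng = {j} \<rparr>"

text \<open>
  The expected cost incurred from the arrival at customer \<open>m\<close> with remaining quantity \<open>q\<close>,
  where \<open>v\<close> is the expected remaining cost after \<open>m\<close> has been served. For \<open>q \<le> cap\<close> the argument
  of \<open>v\<close> lies in \<open>{0..cap}\<close>, since the subtraction does not truncate.
\<close>

definition serve_cost :: "'w vrp \<Rightarrow> nat \<Rightarrow> (nat \<Rightarrow> real) \<Rightarrow> nat \<Rightarrow> real" where
  "serve_cost I m v q =
     (\<Sum>k. ((tcost I m 0 + tcost I 0 m) * real (Psi I k q) + v (cap I * Psi I k q + q - k))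
            * dem_pmf I m k)"

definition extend :: "'w vrp \<Rightarrow> label \<Rightarrow> nat \<Rightarrow> label" where
  "extend I L i =
     \<lparr> node = i,
       rl = rl L - mean_dem I i,
       pr = i # pr L,
       ap = ap L + tcost I i (node L),
       nu = (\<lambda>q. min (tcost I i (node L) + serve_cost I (node L) (nu L) q)
                     (tcost I i 0 + tcost I 0 (node L) + serve_cost I (node L) (nu L) (cap I))),
       Gam = Gam L + gamma I i (node L),
       ng = (ng L \<inter> eta I i) \<union> {i} \<rparr>"

definition ng_feasible_step :: "'w vrp \<Rightarrow> label \<Rightarrow> nat \<Rightarrow> bool" where
  "ng_feasible_step I L i \<longleftrightarrow> i \<in> customers I \<and> mean_dem I i \<le> rl L \<and> i \<notin> ng L"

primrec extend_seq :: "'w vrp \<Rightarrow> label \<Rightarrow> nat list \<Rightarrow> label" where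
  "extend_seq I L [] = L"
| "extend_seq I L (i # e) = extend I (extend_seq I L e) i"

primrec ng_feasible_ext :: "'w vrp \<Rightarrow> label \<Rightarrow> nat list \<Rightarrow> bool" where
  "ng_feasible_ext I L [] \<longleftrightarrow> True"
| "ng_feasible_ext I L (i # e) \<longleftrightarrow>
     ng_feasible_ext I L e \<and> ng_feasible_step I (extend_seq I L e) i"

inductive_set labels :: "'w vrp \<Rightarrow> label set" for I :: "'w vrp" where
  root: "j \<in> customers I \<Longrightarrow> mean_dem I j \<le> lfac I * real (cap I) \<Longrightarrow> root_label I j \<in> labels I"
| step: "L \<in> labels I \<Longrightarrow> ng_feasible_step I L i \<Longrightarrow> extend I L i \<in> labels I"

definition ng_routes :: "'w vrp \<Rightarrow> label \<Rightarrow> nat list set" where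
  "ng_routes I L = {0 # e @ pr L | e. ng_feasible_ext I L e}"

definition label_reduced_cost :: "'w vrp \<Rightarrow> label \<Rightarrow> real" where
  "label_reduced_cost I L =
     tcost I 0 (node L) + serve_cost I (node L) (nu L) (cap I) + Gam L + gamma I 0 (node L)"

text \<open>
  The reduced cost is a function of the route: a label is determined by its partial route, see
  \<open>reduced_cost_label\<close> and \<open>reduced_cost_ng_route\<close> below.
\<close>

definition reduced_cost :: "'w vrp \<Rightarrow> nat list \<Rightarrow> real" where
  "reduced_cost I r = label_reduced_cost I (THE L. L \<in> labels I \<and> r = 0 # pr L)"

definition vrp_graph :: "'w vrp \<Rightarrow> (nat, nat \<times> nat) pre_digraph" where
  "vrp_graph I =
     \<lparr> verts = nodes I, arcs = {(i, j). i \<in> nodes I \<and> j \<in> nodes I \<and> i \<noteq> j},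
       tail = fst, head = snd \<rparr>"

definition arc_cost :: "'w vrp \<Rightarrow> nat \<times> nat \<Rightarrow> real" where
  "arc_cost I a = tcost I (fst a) (snd a) + gamma I (fst a) (snd a)"

definition consumption :: "'w vrp \<Rightarrow> nat list \<Rightarrow> real" where
  "consumption I vs = (\<Sum>i\<leftarrow>vs. if i = 0 then 0 else mean_dem I i)"

definition psi :: "'w vrp \<Rightarrow> nat \<Rightarrow> real \<Rightarrow> ereal" where
  "psi I i C =
     (INF p \<in> {p. pre_digraph.awalk (vrp_graph I) 0 p i \<and>
                  consumption I (pre_digraph.awalk_verts (vrp_graph I) 0 p) \<le> C}.
        ereal (wf_digraph.awalk_cost (arc_cost I) p))"

lemma wf_digraph_vrp_graph: "wf_digraph (vrp_graph I)"
  by unfold_locales (auto simp: vrp_graph_def)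

lemma pr_extend_seq: "pr (extend_seq I L e) = e @ pr L"
  by (induction e) (auto simp: extend_def)

lemma extend_seq_in_labels:
  "L \<in> labels I \<Longrightarrow> ng_feasible_ext I L e \<Longrightarrow> extend_seq I L e \<in> labels I"
  by (induction e) (auto intro: labels.step)

lemma length_pr_label: "L \<in> labels I \<Longrightarrow> 2 \<le> length (pr L)"
  by (induction rule: labels.induct) (auto simp: root_label_def extend_def)

lemma label_determined_by_pr:
  "L \<in> labels I \<Longrightarrow> L' \<in> labels I \<Longrightarrow> pr L = pr L' \<Longrightarrow> L = L'"
proof (induction arbitrary: L' rule: labels.induct)
  case (root j)
  from root(3) show ?case
  proof cases
    case (root j')
    then show ?thesis using root.prems by (auto simp: root_label_def)
  next
    case (step L'' i)
    then have "pr L'' = [0]" using root.prems by (simp add: root_label_def extend_def)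
    with length_pr_label[OF step(2)] show ?thesis by simp
  qed
next
  case (step L i)
  from step.prems(1) show ?case
  proof cases
    case (root j')
    then have "pr L = [0]" using step.prems by (simp add: root_label_def extend_def)
    with length_pr_label[OF step.hyps(1)] show ?thesis by simp
  next
    case (step L'' i')
    then have "i = i'" "pr L = pr L''"
      using step.prems by (auto simp: extend_def)
    then show ?thesis using step.IH step by simp
  qed
qed

lemma reduced_cost_label:
  assumes "L \<in> labels I"
  shows "reduced_cost I (0 # pr L) = label_reduced_cost I L"
proof -
  have "(THE L'. L' \<in> labels I \<and> 0 # pr L = 0 # pr L') = L"
    by (rule the_equality) (use assms in \<open>auto intro: label_determined_by_pr\<close>)
  then show ?thesis by (simp add: reduced_cost_def)
qed

lemma reduced_cost_ng_route:
  assumes "L \<in> labels I" "ng_feasible_ext I L e"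
  shows "reduced_cost I (0 # e @ pr L) = label_reduced_cost I (extend_seq I L e)"
  using reduced_cost_label[OF extend_seq_in_labels[OF assms]] by (simp add: pr_extend_seq)

end

theory Submission
  imports Defs
begin

text \<open>
  Replenishment can only add cost, so for every remaining quantity the expected remaining cost of
  a label is at least its a priori cost; for the preventive return to the depot this is the
  triangle inequality. Hence the reduced cost of a route is at least the a priori cost of the whole
  route plus its dual contributions. This splits into the part inside the label and the value of
  the walk that leads from the depot along the extension to the node of the label, which
  respects the capacity bound because the remaining load never becomes negative.
\<close>

text \<open>The law of \<open>X\<close> has the point probabilities as density with respect to
  counting measure. Reading the series in \<open>serve_cost\<close> as an expectation lets pointwise
  bounds carry over to it.\<close>

lemma (in prob_space) sums_expectation_nat:
  fixes X :: "'a \<Rightarrow> nat" and f :: "nat \<Rightarrow> real"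
  assumes X [measurable]: "X \<in> measurable M (count_space UNIV)"
    and int: "integrable M (\<lambda>w. f (X w))"
  shows "(\<lambda>k. f k * prob {w \<in> space M. X w = k}) sums expectation (\<lambda>w. f (X w))"
proof -
  let ?p = "\<lambda>k. prob {w \<in> space M. X w = k}"
  have distr: "distr M (count_space UNIV) X = density (count_space UNIV) (\<lambda>k. ennreal (?p k))"
  proof (rule measure_eqI_countable[where A = UNIV])
    fix k :: nat
    have "X -` {k} \<inter> space M = {w \<in> space M. X w = k}" by auto
    then show "emeasure (distr M (count_space UNIV) X) {k} =
        emeasure (density (count_space UNIV) (\<lambda>k. ennreal (?p k))) {k}"
      by (simp add: emeasure_distr emeasure_density nn_integral_count_space_indicator[symmetric]
          nn_integral_count_space_finite emeasure_eq_measure)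
  qed auto
  have "integrable (distr M (count_space UNIV) X) f"
    using int by (simp add: integrable_distr_eq)
  then have "integrable (count_space UNIV) (\<lambda>k. f k * ?p k)"
    unfolding distr by (simp add: integrable_density mult.commute)
  then have "(\<lambda>k. f k * ?p k) sums (\<integral>k. f k * ?p k \<partial>count_space UNIV)"
    by (rule sums_integral_count_space_nat)
  also have "(\<integral>k. f k * ?p k \<partial>count_space UNIV) =
      (\<integral>k. f k \<partial>distr M (count_space UNIV) X)"
    unfolding distr by (simp add: integral_density mult.commute)
  also have "\<dots> = expectation (\<lambda>w. f (X w))"
    by (simp add: integral_distr)
  finally show ?thesis .
qed

text \<open>A crude bound, since a capacity of at least 1 serves at least one unit per trip. It
  makes the trip cost integrable whenever the demand has finite mean.\<close>

lemma Psi_le: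
  assumes "0 < cap I"
  shows "Psi I k q \<le> k"
proof -
  have "(real k - real q) / real (cap I) \<le> real k / real (cap I)"
    by (intro divide_right_mono) auto
  also have "\<dots> \<le> real k"
    using assms by (simp add: divide_le_eq mult_le_cancel_left1)
  finally have "\<lceil>(real k - real q) / real (cap I)\<rceil> \<le> int k"
    by (simp add: ceiling_le_iff)
  then show ?thesis by (simp add: Psi_def)
qed

text \<open>Rounding up overshoots the required number of trips by less than one full load. Hence
  \<open>v\<close> is only evaluated where a lower bound on it is assumed.\<close>

lemma remaining_quantity_le_cap:
  assumes "0 < cap I" "q \<le> cap I"
  shows "cap I * Psi I k q + q - k \<le> cap I"
proof (cases "k \<le> q")
  case True
  then have "(real k - real q) / real (cap I) \<le> 0"
    by (simp add: divide_le_0_iff)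
  then have "Psi I k q = 0"
    by (simp add: Psi_def ceiling_le_iff)
  then show ?thesis using assms(2) by simp
next
  case False
  let ?x = "(real k - real q) / real (cap I)"
  have "0 \<le> ?x" using False by simp
  then have "real (Psi I k q) = of_int \<lceil>?x\<rceil>"
    by (simp add: Psi_def)
  also have "\<dots> \<le> ?x + 1" by linarith
  finally have "real (cap I) * real (Psi I k q) \<le> real (cap I) * (?x + 1)"
    by (rule mult_left_mono) simp
  also have "\<dots> = real k - real q + real (cap I)"
    using assms(1) by (simp add: field_simps)
  finally have "real (cap I * Psi I k q + q) \<le> real (k + cap I)"
    by simp
  then show ?thesis by linarith
qed

lemma vrp_graph_simps [simp]:
  "verts (vrp_graph I) = nodes I"
  "arcs (vrp_graph I) = {(i, j). i \<in> nodes I \<and> j \<in> nodes I \<and> i \<noteq> j}"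
  "tail (vrp_graph I) = fst"
  "head (vrp_graph I) = snd"
  by (simp_all add: vrp_graph_def)

context vrpsd
begin

text \<open>Trips cost at least 0, so \<open>c\<close> bounds the cost for every demand value, and
  the probabilities have total mass 1. Integrability comes first because \<open>suminf\<close> and
  the integral are meaningful only with convergence.\<close>

lemma serve_cost_ge:
  assumes m: "m \<in> customers I" and q: "q \<le> cap I"
    and v: "\<And>q. q \<le> cap I \<Longrightarrow> c \<le> v q"
  shows "c \<le> serve_cost I m v q"
proof -
  define f where
    "f k = (tcost I m 0 + tcost I 0 m) * real (Psi I k q) + v (cap I * Psi I k q + q - k)" for k
  have tc: "0 \<le> tcost I m 0 + tcost I 0 m"
    using m by (simp add: tcost_nonneg)
  have X [measurable]: "dem I m \<in> measurable (Omega I) (count_space UNIV)"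
    using indep_dem m unfolding indep_vars_def by blast
  \<comment> \<open>\<open>v\<close> is arbitrary, but only its values on \<open>{0..cap I}\<close>
    occur, so the sum of their moduli dominates it. The bound is then affine in the demand.\<close>
  have bound: "\<bar>f k\<bar> \<le> (tcost I m 0 + tcost I 0 m) * real k + (\<Sum>j\<le>cap I. \<bar>v j\<bar>)" for k
  proof -
    have "\<bar>v (cap I * Psi I k q + q - k)\<bar> \<le> (\<Sum>j\<le>cap I. \<bar>v j\<bar>)"
      using remaining_quantity_le_cap[OF cap_pos q] by (intro member_le_sum) auto
    moreover have "(tcost I m 0 + tcost I 0 m) * real (Psi I k q)
        \<le> (tcost I m 0 + tcost I 0 m) * real k"
      using tc Psi_le[OF cap_pos] by (intro mult_left_mono) auto
    moreover have "0 \<le> (tcost I m 0 + tcost I 0 m) * real (Psi I k q)"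
      using tc by simp
    ultimately show ?thesis unfolding f_def by linarith
  qed
  have int: "integrable (Omega I) (\<lambda>w. f (dem I m w))"
  proof (rule Bochner_Integration.integrable_bound)
    show "integrable (Omega I)
        (\<lambda>w. (tcost I m 0 + tcost I 0 m) * real (dem I m w) + (\<Sum>j\<le>cap I. \<bar>v j\<bar>))"
      using finite_mean[OF m] by simp
  next
    show "AE w in Omega I. norm (f (dem I m w)) \<le>
        norm ((tcost I m 0 + tcost I 0 m) * real (dem I m w) + (\<Sum>j\<le>cap I. \<bar>v j\<bar>))"
    proof (rule AE_I2)
      fix w
      show "norm (f (dem I m w)) \<le>
          norm ((tcost I m 0 + tcost I 0 m) * real (dem I m w) + (\<Sum>j\<le>cap I. \<bar>v j\<bar>))"
        using bound[of "dem I m w"] by simp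
    qed
  qed simp
  have "c \<le> f k" for k
    using tc v[OF remaining_quantity_le_cap[OF cap_pos q, of k]] by (simp add: f_def add_increasing)
  then have "c \<le> expectation (\<lambda>w. f (dem I m w))"
    by (intro integral_ge_const[OF int]) simp
  also have "\<dots> = serve_cost I m v q"
    using sums_expectation_nat[OF X int] sums_unique
    unfolding serve_cost_def dem_pmf_def f_def by blast
  finally show ?thesis .
qed

text \<open>The bound on \<open>nu\<close> drives the cost estimate and \<open>0 \<le> rl L\<close>
  the capacity estimate. That \<open>node L\<close> lies in \<open>ng L\<close> rules out extending
  a label to its own node.\<close>

lemma label_invariants:
  assumes "L \<in> labels I"
  shows "node L \<in> customers I \<and> node L \<in> ng L \<and> 0 \<le> rl L \<and> (\<forall>q \<le> cap I. ap L \<le> nu L q)"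
  using assms
proof (induction rule: labels.induct)
  case (root j)
  then show ?case by (simp add: root_label_def)
next
  case (step L i)
  let ?m = "node L"
  have i: "i \<in> customers I" "mean_dem I i \<le> rl L"
    using step.hyps by (auto simp: ng_feasible_step_def)
  have m: "?m \<in> customers I" and nu: "\<And>q. q \<le> cap I \<Longrightarrow> ap L \<le> nu L q"
    using step.IH by auto
  have serve: "ap L \<le> serve_cost I ?m (nu L) q" if "q \<le> cap I" for q
    by (rule serve_cost_ge[OF m that nu])
  have "tcost I i ?m \<le> tcost I i 0 + tcost I 0 ?m"
    using i(1) m by (intro tcost_triangle) auto
  with serve[of "cap I"] have
    "ap L + tcost I i ?m \<le> tcost I i 0 + tcost I 0 ?m + serve_cost I ?m (nu L) (cap I)"
    by simp
  with serve have "\<forall>q \<le> cap I. ap (extend I L i) \<le> nu (extend I L i) q"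
    by (simp add: extend_def)
  with i show ?case by (simp add: extend_def)
qed

lemma label_reduced_cost_ge:
  assumes "L \<in> labels I"
  shows "arc_cost I (0, node L) + ap L + Gam L \<le> label_reduced_cost I L"
proof -
  have "ap L \<le> serve_cost I (node L) (nu L) (cap I)"
    using label_invariants[OF assms] by (intro serve_cost_ge) auto
  then show ?thesis by (simp add: label_reduced_cost_def arc_cost_def)
qed

interpretation G: wf_digraph "vrp_graph I"
  by (rule wf_digraph_vrp_graph)

text \<open>Each extension step prepends one arc, adding its cost to \<open>ap\<close> and
  \<open>Gam\<close> and its tail's demand to the consumption. The demand of \<open>node L\<close>
  is added separately, as it is already deducted from \<open>rl L\<close> but the walk visits that
  node.\<close>

lemma extension_walk:
  assumes "L \<in> labels I" "ng_feasible_ext I L e"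
  defines "E \<equiv> extend_seq I L e"
  shows "\<exists>p. G.awalk (node E) p (node L) \<and>
    G.awalk_cost (arc_cost I) p + ap L + Gam L = ap E + Gam E \<and>
    consumption I (G.awalk_verts (node E) p) = rl L - rl E + mean_dem I (node L)"
  using assms(2) unfolding E_def
proof (induction e)
  case Nil
  have "node L \<in> customers I" using label_invariants[OF assms(1)] by simp
  then show ?case
    by (intro exI[of _ "[]"])
       (auto simp: G.awalk_Nil_iff consumption_def)
next
  case (Cons i e)
  let ?E = "extend_seq I L e"
  obtain p where p: "G.awalk (node ?E) p (node L)"
      "G.awalk_cost (arc_cost I) p + ap L + Gam L = ap ?E + Gam ?E"
      "consumption I (G.awalk_verts (node ?E) p) = rl L - rl ?E + mean_dem I (node L)"
    using Cons by auto
  have step: "i \<in> customers I" "i \<notin> ng ?E"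
    using Cons.prems by (auto simp: ng_feasible_step_def)
  \<comment> \<open>Together with \<open>i \<notin> ng ?E\<close> this gives
    \<open>i \<noteq> node ?E\<close>: the graph has no loops, so the new pair must be checked to be
    an arc.\<close>
  have E: "node ?E \<in> customers I" "node ?E \<in> ng ?E"
    using label_invariants[OF extend_seq_in_labels[OF assms(1)]] Cons.prems by auto
  let ?p = "(i, node ?E) # p"
  have "G.awalk i ?p (node L)"
    using p(1) step E by (auto simp: G.awalk_Cons_iff)
  moreover have "G.awalk_cost (arc_cost I) ?p + ap L + Gam L
      = ap (extend I ?E i) + Gam (extend I ?E i)"
    using p(2) by (simp add: extend_def arc_cost_def)
  moreover have "consumption I (G.awalk_verts i ?p)
      = rl L - rl (extend I ?E i) + mean_dem I (node L)"
    using p(3) step(1) by (simp add: extend_def consumption_def)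
  moreover have "node (extend_seq I L (i # e)) = i"
    by (simp add: extend_def)
  ultimately show ?case
    by (intro exI[of _ ?p]) simp
qed

text \<open>One explicit walk suffices, since \<open>psi\<close> is an infimum. It may be minus
  infinity; adding the finite reals \<open>ap L\<close> and \<open>Gam L\<close> is still
  monotone.\<close>

lemma psi_bound_le_label_reduced_cost:
  assumes "L \<in> labels I" "ng_feasible_ext I L e"
  shows "psi I (node L) (rl L + mean_dem I (node L)) + ereal (ap L) + ereal (Gam L)
    \<le> ereal (label_reduced_cost I (extend_seq I L e))"
proof -
  let ?E = "extend_seq I L e"
  have E: "?E \<in> labels I" by (rule extend_seq_in_labels[OF assms])
  obtain p where p: "G.awalk (node ?E) p (node L)"
      "G.awalk_cost (arc_cost I) p + ap L + Gam L = ap ?E + Gam ?E"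
      "consumption I (G.awalk_verts (node ?E) p) = rl L - rl ?E + mean_dem I (node L)"
    using extension_walk[OF assms] by blast
  have inv: "node ?E \<in> customers I" "0 \<le> rl ?E"
    using label_invariants[OF E] by auto
  \<comment> \<open>The depot consumes nothing, so the consumption is unchanged and
    \<open>0 \<le> rl ?E\<close> gives the capacity bound.\<close>
  let ?p = "(0, node ?E) # p"
  have "G.awalk 0 ?p (node L)"
    using p(1) inv(1) by (auto simp: G.awalk_Cons_iff)
  moreover have "consumption I (G.awalk_verts 0 ?p) \<le> rl L + mean_dem I (node L)"
    using p(3) inv(2) by (simp add: consumption_def)
  ultimately have "psi I (node L) (rl L + mean_dem I (node L)) \<le> ereal (G.awalk_cost (arc_cost I) ?p)"
    unfolding psi_def by (intro INF_lower) auto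
  then have "psi I (node L) (rl L + mean_dem I (node L)) + ereal (ap L) + ereal (Gam L)
      \<le> ereal (G.awalk_cost (arc_cost I) ?p) + ereal (ap L) + ereal (Gam L)"
    by (intro add_right_mono)
  also have "\<dots> = ereal (arc_cost I (0, node ?E) + ap ?E + Gam ?E)"
    using p(2) by simp
  also have "\<dots> \<le> ereal (label_reduced_cost I ?E)"
    using label_reduced_cost_ge[OF E] by simp
  finally show ?thesis .
qed

end

theorem proposition3:
  fixes I :: "'w vrp" and L :: label
  assumes "vrpsd I"
    and "L \<in> labels I"
  shows "\<forall>r \<in> ng_routes I L.
    psi I (node L) (rl L + mean_dem I (node L)) + ereal (ap L) + ereal (Gam L)
      \<le> ereal (reduced_cost I r)"
  \<comment> \<open>The label is recovered from its route, which resolves the definite description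
    in \<open>reduced_cost\<close>.\<close>
  using vrpsd.psi_bound_le_label_reduced_cost[OF assms(1,2)] reduced_cost_ng_route[OF assms(2)]
  by (auto simp: ng_routes_def)

end
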